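(* Let $G$ be a simple connected graph with $|E(G)|\ge4$ and let $v\in V(G)$. Let $\bar G$ be obtained from $G$ by attaching three new pendant vertices $a,b,c$ to $v$, let $\widetilde G=\bar G+\{a,b\}$, and let $G^*=\bar G+\{a,b\}+\{b,c\}+\{a,c\}$. Then $\mathscr{K}(G^* )>\mathscr{K}(\widetilde G)$.
   Context: For connected $H$ with $m\ge1$ edges and degrees $d_i$, Kemeny's constant is $\mathscr{K}(H)=\sum_j\pi_jm_{ij}$ for the simple random walk on $H$ ($\pi_j=d_j/2m$, $m_{ij}$ expected hitting time of $j$ from $i$, $m_{jj}=0$), equivalently $\frac1{4m}\sum_{i,j}d_id_jr_H(i,j)$ with $r_H$ effective resistance. $H+\{x,y\}$ denotes $H$ with the edge $\{x,y\}$ added. *)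

theory Defs
  imports "HOL-Probability.Probability" "Graph_Theory.Digraph_Component"
begin

text \<open>
  A finite simple graph is a \<^locale>\<open>pair_graph\<close>: a finite, loop-free, symmetric set of arcs.
  Every undirected edge is thus represented by two opposite arcs, and edges are counted as
  unordered pairs.
\<close>

definition uedges :: "'a pair_pre_digraph \<Rightarrow> 'a set set" where
  "uedges G = (\<lambda>(x, y). {x, y}) ` parcs G"

definition neighbours :: "'a pair_pre_digraph \<Rightarrow> 'a \<Rightarrow> 'a set" where
  "neighbours G x = {y. (x, y) \<in> parcs G}"

definition vertex_degree :: "'a pair_pre_digraph \<Rightarrow> 'a \<Rightarrow> nat" where
  "vertex_degree G x = card (neighbours G x)"

definition add_edge :: "'a pair_pre_digraph \<Rightarrow> 'a \<Rightarrow> 'a \<Rightarrow> 'a pair_pre_digraph" where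
  "add_edge G x y = \<lparr>pverts = pverts G, parcs = parcs G \<union> {(x, y), (y, x)}\<rparr>"

definition attach_pendant :: "'a pair_pre_digraph \<Rightarrow> 'a \<Rightarrow> 'a \<Rightarrow> 'a pair_pre_digraph" where
  "attach_pendant G v x =
    \<lparr>pverts = insert x (pverts G), parcs = parcs G \<union> {(v, x), (x, v)}\<rparr>"

text \<open>
  \<open>walk_law G n i\<close> is the joint law of the first \<open>n + 1\<close> states \<open>[X\<^sub>0, \<dots>, X\<^sub>n]\<close> of the simple
  random walk on \<open>G\<close> started at \<open>i\<close>. It is meaningful when no vertex reachable from \<open>i\<close> is
  isolated.
\<close>

primrec walk_law :: "'a pair_pre_digraph \<Rightarrow> nat \<Rightarrow> 'a \<Rightarrow> 'a list pmf" where
  "walk_law G 0 i = return_pmf [i]"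
| "walk_law G (Suc n) i =
    bind_pmf (pmf_of_set (neighbours G i)) (\<lambda>k. map_pmf ((#) i) (walk_law G n k))"

text \<open>The probability that \<open>T\<^sub>j = n\<close>, where \<open>T\<^sub>j = min {k \<ge> 0. X\<^sub>k = j}\<close>.\<close>

definition hitting_prob :: "'a pair_pre_digraph \<Rightarrow> 'a \<Rightarrow> 'a \<Rightarrow> nat \<Rightarrow> real" where
  "hitting_prob G i j n =
    measure_pmf.prob (walk_law G n i) {xs. xs ! n = j \<and> (\<forall>k<n. xs ! k \<noteq> j)}"

text \<open>
  The expectation of \<open>T\<^sub>j\<close>. On a finite connected graph \<open>T\<^sub>j\<close> is almost surely finite and the series
  converges; otherwise the value has no meaning.
\<close>

definition hitting_time :: "'a pair_pre_digraph \<Rightarrow> 'a \<Rightarrow> 'a \<Rightarrow> real" where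
  "hitting_time G i j = (\<Sum>n. real n * hitting_prob G i j n)"

definition stationary :: "'a pair_pre_digraph \<Rightarrow> 'a \<Rightarrow> real" where
  "stationary G j = real (vertex_degree G j) / (2 * real (card (uedges G)))"

text \<open>The sum defining Kemeny's constant does not depend on the starting vertex \<open>i\<close>.\<close>

definition kemeny :: "'a pair_pre_digraph \<Rightarrow> real" where
  "kemeny G =
    (THE \<kappa>. \<forall>i \<in> pverts G. (\<Sum>j \<in> pverts G. stationary G j * hitting_time G i j) = \<kappa>)"

end

theory Submission
  imports Defs
begin

text \<open>
  The hitting times \<open>h\<close> of a vertex \<open>j\<close> satisfy \<open>\<Delta>h(i) = d\<^sub>i\<close> for \<open>i \<noteq> j\<close>, and \<open>\<Delta>h\<close> sums to zero, which
  gives \<open>\<Delta>h(j) = d\<^sub>j - 2m\<close>. Hence \<open>\<Sum>\<^sub>j \<pi>\<^sub>j h\<^sub>j\<close> is harmonic, that is constant, and Kemeny's constant may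
  be evaluated from the cut vertex \<open>v\<close>.

  Let \<open>m = |E(G)|\<close>; the gadgets at \<open>v\<close> have 4 and 6 edges. For a target \<open>j\<close> in \<open>G\<close>, eliminating the
  gadget vertices turns the equation at \<open>v\<close> into \<open>\<Delta>\<^sub>G h(v) = d\<^sub>v + 2M\<close> with \<open>M\<close> the number of gadget
  edges. So \<open>u = (m + 4) h\<^sup>* - (m + 6) h\<^sup>~\<close> has \<open>\<Delta>\<^sub>G u(i) = -2 d\<^sub>i\<close> for all \<open>i \<noteq> v\<close>, including \<open>i = j\<close>, and
  the maximum principle gives \<open>u(v) \<ge> u(j) = 0\<close>. For targets in the gadget, the total flow \<open>2m\<close> out of
  \<open>G\<close> leaves a linear system in three unknowns. What remains is \<open>5m\<^sup>2 - 4m - 42 > 0\<close>.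
\<close>

section \<open>The graph Laplacian and its linearity\<close>

definition laplacian :: "'a pair_pre_digraph \<Rightarrow> ('a \<Rightarrow> real) \<Rightarrow> 'a \<Rightarrow> real" where
  "laplacian H f i = (\<Sum>k\<in>neighbours H i. f i - f k)"

lemma laplacian_eq:
  "laplacian H f i = real (vertex_degree H i) * f i - (\<Sum>k\<in>neighbours H i. f k)"
  by (simp add: laplacian_def sum_subtractf vertex_degree_def)

lemma laplacian_cmult: "laplacian H (\<lambda>i. x * f i) i = x * laplacian H f i"
  by (simp add: laplacian_def sum_distrib_left right_diff_distrib)

lemma laplacian_diff: "laplacian H (\<lambda>i. f i - g i) i = laplacian H f i - laplacian H g i"
  unfolding laplacian_def sum_subtractf[symmetric] by (rule sum.cong) auto

lemma laplacian_sum: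
  "laplacian H (\<lambda>i. \<Sum>j\<in>A. f j i) i = (\<Sum>j\<in>A. laplacian H (f j) i)"
  unfolding laplacian_def sum_subtractf[symmetric] by (rule sum.swap)

section \<open>Connected graphs: degree sums, the maximum principle and a uniform bound\<close>

locale connected_simple_graph =
  fixes H :: "'a pair_pre_digraph"
  assumes finite_verts: "finite (pverts H)"
    and arcs_verts: "parcs H \<subseteq> pverts H \<times> pverts H"
    and arcs_sym: "(x, y) \<in> parcs H \<Longrightarrow> (y, x) \<in> parcs H"
    and no_loop: "(x, x) \<notin> parcs H"
    and reach: "x \<in> pverts H \<Longrightarrow> y \<in> pverts H \<Longrightarrow> (x, y) \<in> (parcs H)\<^sup>*"
    and arcs_nonempty: "parcs H \<noteq> {}"
begin

abbreviation "V \<equiv> pverts H"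
abbreviation "N \<equiv> neighbours H"
abbreviation "deg \<equiv> vertex_degree H"
abbreviation "m \<equiv> card (uedges H)"

lemma finite_arcs: "finite (parcs H)"
  using arcs_verts finite_verts by (auto intro: finite_subset)

lemma neighbours_subset: "N i \<subseteq> V"
  using arcs_verts by (auto simp: neighbours_def)

lemma finite_neighbours: "finite (N i)"
  using neighbours_subset finite_verts finite_subset by blast

lemma neighbours_sym: "k \<in> N i \<longleftrightarrow> i \<in> N k"
  using arcs_sym by (auto simp: neighbours_def)

text \<open>Spreads a property from one vertex over the whole graph, one edge at a time. This is the
  form in which connectivity enters the maximum principle and the uniform bound.\<close>

lemma reach_induct [consumes 2, case_names base step]:
  assumes "x \<in> V" "y \<in> V" "P x"
    and "\<And>k i. k \<in> V \<Longrightarrow> i \<in> V \<Longrightarrow> k \<in> N i \<Longrightarrow> P k \<Longrightarrow> P i"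
  shows "P y"
proof -
  have "(x, y) \<in> (parcs H)\<^sup>*"
    using reach assms by auto
  then show ?thesis
  proof (induction rule: rtrancl_induct)
    case base
    show ?case by fact
  next
    case (step k i)
    then show ?case
      using assms(4)[of k i] arcs_verts arcs_sym by (auto simp: neighbours_def)
  qed
qed

text \<open>Some arc exists, so some vertex has a neighbour. A vertex reached in an induction step
  has its predecessor as a neighbour.\<close>

lemma neighbours_nonempty:
  assumes "i \<in> V"
  shows "N i \<noteq> {}"
proof -
  obtain x y where xy: "(x, y) \<in> parcs H"
    using arcs_nonempty by auto
  then have "x \<in> V"
    using arcs_verts by auto
  from this assms show ?thesis
  proof (induction rule: reach_induct)
    case base
    show ?case using xy by (auto simp: neighbours_def)
  next
    case (step k i)
    then show ?case by auto
  qed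
qed

lemma deg_pos: "i \<in> V \<Longrightarrow> deg i > 0"
  using finite_neighbours neighbours_nonempty by (simp add: vertex_degree_def card_gt_0_iff)

text \<open>Both sides count arcs: grouped by first endpoint they give the degree sum, and grouped
  by underlying edge every group has exactly two members, since there are no loops.\<close>

lemma handshake: "(\<Sum>i\<in>V. deg i) = 2 * m"
proof -
  have "(\<Sum>i\<in>V. deg i) = card (Sigma V N)"
    using finite_verts finite_neighbours by (simp add: vertex_degree_def card_SigmaI)
  also have "Sigma V N = parcs H"
    using arcs_verts by (auto simp: neighbours_def)
  also have "card (parcs H) = (\<Sum>e\<in>uedges H. card {p \<in> parcs H. (\<lambda>(x, y). {x, y}) p = e})"
    unfolding uedges_def using sum.image_gen[OF finite_arcs, of "\<lambda>_. 1::nat"] by simp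
  also have "\<dots> = (\<Sum>e\<in>uedges H. 2)"
  proof (rule sum.cong)
    fix e assume "e \<in> uedges H"
    then obtain x y where xy: "(x, y) \<in> parcs H" "e = {x, y}"
      by (auto simp: uedges_def)
    then have "{p \<in> parcs H. (\<lambda>(x, y). {x, y}) p = e} = {(x, y), (y, x)}"
      using arcs_sym by (auto simp: doubleton_eq_iff)
    moreover have "x \<noteq> y"
      using xy no_loop by auto
    ultimately show "card {p \<in> parcs H. (\<lambda>(x, y). {x, y}) p = e} = 2"
      by simp
  qed simp
  finally show ?thesis by simp
qed

lemma m_pos: "m > 0"
  using finite_arcs arcs_nonempty by (simp add: uedges_def card_gt_0_iff)

lemma sum_neighbours:
  fixes g :: "'a \<Rightarrow> real"
  shows "(\<Sum>k\<in>N i. g k) = (\<Sum>k\<in>V. if k \<in> N i then g k else 0)"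
  using sum.inter_restrict[OF finite_verts, of g "N i"] neighbours_subset[of i]
  by (simp add: Int_absorb1)

text \<open>By symmetry of adjacency, \<open>f k\<close> is subtracted once for each neighbour of
  \<open>k\<close>, which is how often it is added at \<open>k\<close> itself.\<close>

lemma sum_laplacian: "(\<Sum>i\<in>V. laplacian H f i) = 0"
proof -
  have "(\<Sum>i\<in>V. \<Sum>k\<in>N i. f k) = (\<Sum>i\<in>V. \<Sum>k\<in>V. if k \<in> N i then f k else 0)"
    by (simp only: sum_neighbours)
  also have "\<dots> = (\<Sum>k\<in>V. \<Sum>i\<in>V. if i \<in> N k then f k else 0)"
    using neighbours_sym by (subst sum.swap) simp
  also have "\<dots> = (\<Sum>k\<in>V. real (deg k) * f k)"
    by (simp add: vertex_degree_def flip: sum_neighbours)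
  finally show ?thesis
    by (simp add: laplacian_eq sum_subtractf)
qed

text \<open>Supplies the one equation that first-step analysis does not give, the one at the target:
  the zero sum forces it.\<close>

lemma laplacian_at_target:
  assumes "j \<in> V" "\<And>i. i \<in> V \<Longrightarrow> i \<noteq> j \<Longrightarrow> laplacian H f i = g i"
  shows "laplacian H f j = - (\<Sum>i\<in>V - {j}. g i)"
proof -
  have "0 = laplacian H f j + (\<Sum>i\<in>V - {j}. laplacian H f i)"
    using sum_laplacian[of f] sum.remove[OF finite_verts assms(1), of "laplacian H f"] by simp
  also have "(\<Sum>i\<in>V - {j}. laplacian H f i) = (\<Sum>i\<in>V - {j}. g i)"
    using assms(2) by (intro sum.cong) auto
  finally show ?thesis by simp
qed

lemma sum_deg_remove: "j \<in> V \<Longrightarrow> (\<Sum>i\<in>V - {j}. real (deg i)) = 2 * real m - real (deg j)"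
  using handshake sum.remove[OF finite_verts, of j "\<lambda>i. real (deg i)"]
  by (simp flip: of_nat_sum)

text \<open>At a maximiser \<open>k\<close> other than \<open>v\<close>, the differences
  \<open>u k - u l\<close> over neighbours are nonnegative with nonpositive sum. All vanish, so the
  maximum spreads along edges until it reaches \<open>v\<close>.\<close>

lemma maximum_principle:
  assumes "v \<in> V" "i \<in> V"
    and sub: "\<And>i. i \<in> V \<Longrightarrow> i \<noteq> v \<Longrightarrow> laplacian H u i \<le> 0"
  shows "u i \<le> u v"
proof -
  define M where "M = Max (u ` V)"
  have le: "u k \<le> M" if "k \<in> V" for k
    using that finite_verts by (simp add: M_def)
  have "M \<in> u ` V"
    unfolding M_def using finite_verts assms by (intro Max_in) auto
  then obtain x where x: "x \<in> V" "u x = M" by auto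
  have "u v = M"
  proof (rule ccontr)
    assume "u v \<noteq> M"
    \<comment> \<open>The contrary assumption keeps the induction going: a vertex with value
      \<open>M\<close> cannot be \<open>v\<close>, so \<open>sub\<close> applies to it.\<close>
    from x(1) assms(1) have "u v = M"
    proof (induction rule: reach_induct)
      case base
      show ?case by fact
    next
      case (step k i)
      then have "k \<noteq> v"
        using \<open>u v \<noteq> M\<close> by auto
      have nonneg: "u k - u l \<ge> 0" if "l \<in> N k" for l
        using that le neighbours_subset[of k] step by auto
      have "laplacian H u k = 0"
        using sub[OF step(1) \<open>k \<noteq> v\<close>] sum_nonneg[of "N k" "\<lambda>l. u k - u l"] nonneg
        by (auto simp: laplacian_def)
      then have "\<forall>l\<in>N k. u k - u l = 0"
        unfolding laplacian_def
        by (subst (asm) sum_nonneg_eq_0_iff) (use nonneg finite_neighbours in auto)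
      then show ?case
        using step neighbours_sym by auto
    qed
    then show False
      using \<open>u v \<noteq> M\<close> by simp
  qed
  then show ?thesis
    using le assms by auto
qed

text \<open>The maximum principle applies with either of the two vertices as the exceptional
  one.\<close>

lemma harmonic_constant:
  assumes "i \<in> V" "k \<in> V" "\<And>i. i \<in> V \<Longrightarrow> laplacian H u i = 0"
  shows "u i = u k"
proof (rule antisym)
  show "u i \<le> u k"
    by (rule maximum_principle) (use assms in simp_all)
  show "u k \<le> u i"
    by (rule maximum_principle) (use assms in simp_all)
qed

text \<open>
  If \<open>f\<close> is at most \<open>M\<close> everywhere and bounded by \<open>(1 - \<epsilon>) M + C\<close> at one vertex, then averaging
  gives a bound of the same form at its neighbours; at a maximiser of \<open>f\<close> this bounds \<open>M\<close>.
\<close>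

lemma laplacian_bounded:
  assumes j: "j \<in> V"
  shows "\<exists>B. \<forall>f. f j = 0 \<longrightarrow> (\<forall>i\<in>V - {j}. laplacian H f i \<le> deg i) \<longrightarrow> (\<forall>i\<in>V. f i \<le> B)"
proof -
  define adm where
    "adm f \<longleftrightarrow> f j = 0 \<and> (\<forall>i\<in>V - {j}. laplacian H f i \<le> deg i)" for f :: "'a \<Rightarrow> real"
  have "\<exists>\<epsilon> C. \<epsilon> > 0 \<and> (\<forall>f M. adm f \<longrightarrow> (\<forall>k\<in>V. f k \<le> M) \<longrightarrow> f i \<le> (1 - \<epsilon>) * M + C)"
    if "i \<in> V" for i
    using j that
  proof (induction rule: reach_induct)
    case base
    show ?case by (rule exI[of _ 1], rule exI[of _ 0]) (auto simp: adm_def)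
  next
    case (step k i)
    then obtain \<epsilon> C where "\<epsilon> > 0"
      and IH: "\<And>f M. adm f \<Longrightarrow> (\<forall>k\<in>V. f k \<le> M) \<Longrightarrow> f k \<le> (1 - \<epsilon>) * M + C"
      by blast
    show ?case
    proof (cases "i = j")
      case True
      then show ?thesis
        by (intro exI[of _ 1] exI[of _ 0]) (auto simp: adm_def)
    next
      case False
      have d: "deg i > 0" using deg_pos step by auto
      have "f i \<le> (1 - \<epsilon> / deg i) * M + (1 + C / deg i)" if f: "adm f" "\<forall>k\<in>V. f k \<le> M" for f M
      proof -
        have "(\<Sum>l\<in>N i. f l) = f k + (\<Sum>l\<in>N i - {k}. f l)"
          using step finite_neighbours by (simp add: sum.remove)
        also have "\<dots> \<le> ((1 - \<epsilon>) * M + C) + (\<Sum>l\<in>N i - {k}. M)"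
          using IH[OF f] f neighbours_subset by (intro add_mono sum_mono) auto
        also have "(\<Sum>l\<in>N i - {k}. M) = (real (deg i) - 1) * M"
          using step finite_neighbours d by (simp add: vertex_degree_def of_nat_diff)
        finally have "deg i * f i \<le> deg i + ((1 - \<epsilon>) * M + C) + (real (deg i) - 1) * M"
          using f False step by (force simp: adm_def laplacian_eq)
        also have "\<dots> = deg i * ((1 - \<epsilon> / deg i) * M + (1 + C / deg i))"
          using d by (simp add: divide_simps) (simp add: algebra_simps)
        finally have "deg i * f i \<le> deg i * ((1 - \<epsilon> / deg i) * M + (1 + C / deg i))" .
        then show ?thesis using d by simp
      qed
      then show ?thesis
        using \<open>\<epsilon> > 0\<close> d
        by (intro exI[of _ "\<epsilon> / deg i"] exI[of _ "1 + C / deg i"]) auto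
    qed
  qed
  then obtain \<epsilon> C where \<epsilon>: "\<And>i. i \<in> V \<Longrightarrow> \<epsilon> i > 0"
    and bound: "\<And>i f M. i \<in> V \<Longrightarrow> adm f \<Longrightarrow> (\<forall>k\<in>V. f k \<le> M) \<Longrightarrow> f i \<le> (1 - \<epsilon> i) * M + C i"
    by metis
  define B where "B = Max ((\<lambda>i. C i / \<epsilon> i) ` V)"
  have "f i \<le> B" if f: "adm f" and "i \<in> V" for f i
  proof -
    define M where "M = Max (f ` V)"
    have le: "\<forall>k\<in>V. f k \<le> M"
      using finite_verts by (simp add: M_def)
    have "M \<in> f ` V"
      unfolding M_def using finite_verts j by (intro Max_in) auto
    then obtain x where x: "x \<in> V" "f x = M" by auto
    have "\<epsilon> x * M \<le> C x"
      using bound[OF x(1) f le] x by (simp add: algebra_simps)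
    then have "M \<le> C x / \<epsilon> x"
      using \<epsilon>[OF x(1)] by (simp add: field_simps)
    also have "\<dots> \<le> B"
      using x finite_verts by (simp add: B_def)
    finally show ?thesis
      using le \<open>i \<in> V\<close> by force
  qed
  then show ?thesis
    unfolding adm_def by blast
qed

section \<open>First-step analysis of hitting times\<close>

lemma hitting_prob_0: "hitting_prob H i j 0 = (if i = j then 1 else 0)"
  by (simp add: hitting_prob_def indicator_def)

lemma hitting_prob_Suc_same: "hitting_prob H j j (Suc n) = 0"
proof -
  have "((#) j) -` {xs. xs ! Suc n = j \<and> (\<forall>k<Suc n. xs ! k \<noteq> j)} = {}"
    by auto
  then show ?thesis
    by (simp add: hitting_prob_def measure_def del: vimage_Collect_eq)
qed

lemma hitting_time_term_same: "real n * hitting_prob H j j n = 0"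
  by (cases n) (auto simp: hitting_prob_Suc_same)

text \<open>Condition on the first step. As \<open>i\<close> differs from \<open>j\<close>, index 0
  imposes nothing, and deleting the head of the list shifts the event by one.\<close>

lemma hitting_prob_Suc:
  assumes "i \<in> V" "i \<noteq> j"
  shows "hitting_prob H i j (Suc n) = (\<Sum>k\<in>N i. hitting_prob H k j n) / deg i"
proof -
  let ?A = "{xs. xs ! Suc n = j \<and> (\<forall>k<Suc n. xs ! k \<noteq> j)}"
  let ?q = "\<lambda>k. map_pmf ((#) i) (walk_law H n k)"
  have vim: "((#) i) -` ?A = {xs. xs ! n = j \<and> (\<forall>k<n. xs ! k \<noteq> j)}"
    using assms by (auto simp: All_less_Suc2)
  have "hitting_prob H i j (Suc n) = measure_pmf.prob (bind_pmf (pmf_of_set (N i)) ?q) ?A"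
    by (simp add: hitting_prob_def)
  also have "\<dots> = measure_pmf.expectation (pmf_of_set (N i)) (\<lambda>k. measure_pmf.prob (?q k) ?A)"
    unfolding measure_pmf_bind
    by (rule measure_pmf.measure_bind[where N = "count_space UNIV"]) (auto simp: measure_pmf_in_subprob_algebra)
  also have "\<dots> = (\<Sum>k\<in>N i. measure_pmf.prob (?q k) ?A) / card (N i)"
    using neighbours_nonempty[OF assms(1)] finite_neighbours by (intro integral_pmf_of_set)
  also have "\<dots> = (\<Sum>k\<in>N i. hitting_prob H k j n) / deg i"
    unfolding measure_map_pmf vim hitting_prob_def vertex_degree_def ..
  finally show ?thesis .
qed

lemma hitting_prob_nonneg: "hitting_prob H i j n \<ge> 0"
  by (simp add: hitting_prob_def)

text \<open>For different \<open>n\<close> the events live in different laws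
  \<open>walk_law H n i\<close>, so disjointness cannot be quoted directly. Instead the bound is
  averaged over the first step, by induction on the number of terms.\<close>

lemma sum_hitting_prob_le_1:
  assumes "i \<in> V"
  shows "(\<Sum>n\<le>L. hitting_prob H i j n) \<le> 1"
  using assms
proof (induction L arbitrary: i)
  case 0
  show ?case by (simp add: hitting_prob_0)
next
  case (Suc L)
  show ?case
  proof (cases "i = j")
    case True
    then show ?thesis
      unfolding sum.atMost_Suc_shift by (simp add: hitting_prob_0 hitting_prob_Suc_same)
  next
    case False
    have "(\<Sum>n\<le>Suc L. hitting_prob H i j n) = (\<Sum>n\<le>L. (\<Sum>k\<in>N i. hitting_prob H k j n) / deg i)"
      unfolding sum.atMost_Suc_shift using False Suc
      by (simp add: hitting_prob_0 hitting_prob_Suc)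
    also have "\<dots> = (\<Sum>k\<in>N i. \<Sum>n\<le>L. hitting_prob H k j n) / deg i"
      unfolding sum_divide_distrib[symmetric] by (subst sum.swap) simp
    also have "\<dots> \<le> (\<Sum>k\<in>N i. 1) / deg i"
      using Suc.IH neighbours_subset by (intro divide_right_mono sum_mono) auto
    also have "\<dots> \<le> 1"
      by (simp add: vertex_degree_def)
    finally show ?thesis .
  qed
qed

lemma sum_lessThan_hitting_prob_le_1:
  assumes "i \<in> V"
  shows "(\<Sum>n<L. hitting_prob H i j n) \<le> 1"
  using sum_hitting_prob_le_1[OF assms, of j L] hitting_prob_nonneg[of i j L]
  by (simp add: lessThan_Suc_atMost[symmetric])

lemma summable_hitting_prob: "i \<in> V \<Longrightarrow> summable (hitting_prob H i j)"
  by (rule summableI_nonneg_bounded[OF hitting_prob_nonneg sum_lessThan_hitting_prob_le_1])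

text \<open>The truncated expectations \<open>F L\<close> increase with \<open>L\<close>, and
  first-step analysis expresses \<open>F (Suc L)\<close> through \<open>F L\<close>. Hence
  \<open>F L\<close> satisfies the hitting time equation as an inequality, and
  \<open>laplacian_bounded\<close> bounds it independently of \<open>L\<close>.\<close>

lemma summable_hitting_time:
  assumes "i \<in> V" "j \<in> V"
  shows "summable (\<lambda>n. real n * hitting_prob H i j n)"
proof -
  define F where "F L i = (\<Sum>n<L. real n * hitting_prob H i j n)" for L i
  have F_j: "F L j = 0" for L
    unfolding F_def by (simp only: hitting_time_term_same sum.neutral_const)
  have F_lap: "laplacian H (F L) i \<le> deg i" if i: "i \<in> V - {j}" for L i
  proof -
    have d: "deg i > 0" using deg_pos i by auto
    have "F L i \<le> F (Suc L) i"
      by (simp add: F_def hitting_prob_nonneg)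
    also have "F (Suc L) i = (\<Sum>n<L. (real n + 1) * ((\<Sum>k\<in>N i. hitting_prob H k j n) / deg i))"
      unfolding F_def sum.lessThan_Suc_shift using i by (simp add: hitting_prob_Suc add_ac)
    also have "\<dots> = (\<Sum>n<L. \<Sum>k\<in>N i. (real n + 1) * hitting_prob H k j n) / deg i"
      by (simp add: sum_divide_distrib sum_distrib_left)
    also have "\<dots> = (\<Sum>k\<in>N i. F L k + (\<Sum>n<L. hitting_prob H k j n)) / deg i"
      by (subst sum.swap) (simp add: F_def distrib_right sum.distrib)
    also have "\<dots> \<le> (\<Sum>k\<in>N i. F L k + 1) / deg i"
      using neighbours_subset
      by (intro divide_right_mono sum_mono add_left_mono sum_lessThan_hitting_prob_le_1) auto
    finally show ?thesis
      using d by (simp add: laplacian_eq sum.distrib field_simps vertex_degree_def)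
  qed
  obtain B where "\<And>f. f j = 0 \<Longrightarrow> (\<forall>i\<in>V - {j}. laplacian H f i \<le> deg i) \<Longrightarrow> (\<forall>i\<in>V. f i \<le> B)"
    using laplacian_bounded[OF assms(2)] by blast
  then have "F L i \<le> B" for L
    using F_j F_lap assms(1) by blast
  then show ?thesis
    unfolding F_def by (intro summableI_nonneg_bounded) (auto simp: hitting_prob_nonneg)
qed

text \<open>The probability of ever reaching \<open>j\<close> is harmonic away from \<open>j\<close>
  and equals 1 at \<open>j\<close>. The maximum principle for it and for its negative makes it
  constant.\<close>

lemma suminf_hitting_prob:
  assumes "i \<in> V" "j \<in> V"
  shows "(\<Sum>n. hitting_prob H i j n) = 1"
proof -
  define g where "g i = (\<Sum>n. hitting_prob H i j n)" for i
  have lap: "laplacian H g i = 0" if "i \<in> V" "i \<noteq> j" for i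
  proof -
    have "g i = (\<Sum>n. hitting_prob H i j (Suc n))"
      unfolding g_def using that
      by (subst suminf_split_head[OF summable_hitting_prob]) (auto simp: hitting_prob_0)
    also have "\<dots> = (\<Sum>n. \<Sum>k\<in>N i. hitting_prob H k j n) / deg i"
      using that neighbours_subset
      by (simp add: hitting_prob_Suc) (subst suminf_divide; auto intro!: summable_sum summable_hitting_prob)
    also have "(\<Sum>n. \<Sum>k\<in>N i. hitting_prob H k j n) = (\<Sum>k\<in>N i. g k)"
      unfolding g_def using neighbours_subset
      by (intro suminf_sum summable_hitting_prob) auto
    finally show ?thesis
      using deg_pos[OF that(1)] by (simp add: laplacian_eq)
  qed
  have "g i \<le> g j"
    by (rule maximum_principle[of j i g]) (use assms lap in auto)
  moreover have "- 1 * g i \<le> - 1 * g j"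
    using assms lap
    by (intro maximum_principle[of j i "\<lambda>i. - 1 * g i"]) (simp_all only: laplacian_cmult, simp)
  moreover have "g j = 1"
    using suminf_split_head[OF summable_hitting_prob[OF assms(2), of j]]
    by (simp add: g_def hitting_prob_0 hitting_prob_Suc_same)
  ultimately show ?thesis
    by (simp add: g_def)
qed

lemma hitting_time_same: "hitting_time H j j = 0"
  unfolding hitting_time_def by (simp only: hitting_time_term_same suminf_zero)

text \<open>In the first-step recursion the index shift turns \<open>n\<close> into
  \<open>n + 1\<close>. The extra copy of the probabilities sums to 1 for each neighbour because the
  target is reached almost surely.\<close>

lemma laplacian_hitting_time:
  assumes "i \<in> V" "j \<in> V" "i \<noteq> j"
  shows "laplacian H (\<lambda>i. hitting_time H i j) i = deg i"
proof -
  have s: "summable (\<lambda>n. real n * hitting_prob H k j n + hitting_prob H k j n)" if "k \<in> N i" for k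
    using that neighbours_subset assms
    by (intro summable_add summable_hitting_time summable_hitting_prob) auto
  have "hitting_time H i j = (\<Sum>n. real (Suc n) * hitting_prob H i j (Suc n))"
    unfolding hitting_time_def
    by (subst suminf_split_head[OF summable_hitting_time]) (use assms in auto)
  also have "\<dots> = (\<Sum>n. (\<Sum>k\<in>N i. real n * hitting_prob H k j n + hitting_prob H k j n) / deg i)"
    using assms by (simp add: hitting_prob_Suc sum.distrib sum_distrib_left[symmetric] algebra_simps)
  also have "\<dots> = (\<Sum>n. (\<Sum>k\<in>N i. real n * hitting_prob H k j n + hitting_prob H k j n)) / deg i"
    using s by (intro suminf_divide summable_sum)
  also have "(\<Sum>n. (\<Sum>k\<in>N i. real n * hitting_prob H k j n + hitting_prob H k j n)) =
      (\<Sum>k\<in>N i. \<Sum>n. real n * hitting_prob H k j n + hitting_prob H k j n)"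
    using s by (intro suminf_sum)
  also have "\<dots> = (\<Sum>k\<in>N i. hitting_time H k j + 1)"
  proof (rule sum.cong)
    fix k assume "k \<in> N i"
    then have "k \<in> V" using neighbours_subset by auto
    then show "(\<Sum>n. real n * hitting_prob H k j n + hitting_prob H k j n) = hitting_time H k j + 1"
      using assms
      by (subst suminf_add[symmetric])
        (auto simp: suminf_hitting_prob hitting_time_def intro: summable_hitting_time summable_hitting_prob)
  qed simp
  finally show ?thesis
    using deg_pos[OF assms(1)] by (simp add: laplacian_eq sum.distrib vertex_degree_def)
qed

section \<open>Kemeny's constant from a chosen starting vertex\<close>

lemma kemeny_eq:
  assumes "v \<in> V"
  shows "kemeny H = (\<Sum>j\<in>V. deg j * hitting_time H v j) / (2 * m)"
proof -
  define \<kappa> where "\<kappa> i = (\<Sum>j\<in>V. stationary H j * hitting_time H i j)" for i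
  have "laplacian H \<kappa> i = 0" if i: "i \<in> V" for i
  proof -
    have same: "laplacian H (\<lambda>i. hitting_time H i i') i' = real (deg i') - 2 * real m" if "i' \<in> V" for i'
      using laplacian_at_target[OF that, of "\<lambda>i. hitting_time H i i'" "\<lambda>i. deg i"]
        laplacian_hitting_time sum_deg_remove that by simp
    have "laplacian H \<kappa> i = (\<Sum>j\<in>V. stationary H j * laplacian H (\<lambda>i. hitting_time H i j) i)"
      unfolding \<kappa>_def by (simp add: laplacian_sum laplacian_cmult)
    \<comment> \<open>Every target contributes \<open>deg i\<close>; the target \<open>j = i\<close>
      has the additional defect \<open>2 * m\<close>. Weighted by the stationary law, the two totals
      are \<open>deg i\<close> each and cancel.\<close>
    also have "\<dots> = (\<Sum>j\<in>V. stationary H j * deg i - (if j = i then stationary H j * (2 * m) else 0))"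
      using i laplacian_hitting_time same
      by (intro sum.cong) (auto simp: right_diff_distrib)
    also have "\<dots> = deg i * (\<Sum>j\<in>V. stationary H j) - stationary H i * (2 * m)"
      using i finite_verts by (simp add: sum_subtractf sum_distrib_left mult.commute)
    also have "(\<Sum>j\<in>V. stationary H j) = 1"
      using m_pos handshake by (simp add: stationary_def sum_divide_distrib[symmetric] flip: of_nat_sum)
    finally show ?thesis
      using m_pos by (simp add: stationary_def)
  qed
  then have "\<kappa> i = \<kappa> v" if "i \<in> V" for i
    using harmonic_constant that assms by blast
  then have "kemeny H = \<kappa> v"
    unfolding kemeny_def \<kappa>_def[symmetric] using assms by (intro the_equality) metis+
  also have "\<dots> = (\<Sum>j\<in>V. deg j * hitting_time H v j) / (2 * m)"
    unfolding \<kappa>_def stationary_def sum_divide_distrib by (simp only: times_divide_eq_left of_nat_mult of_nat_numeral)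
  finally show ?thesis .
qed

end

section \<open>Pendant vertices, added edges and connectivity\<close>

lemma pverts_attach_pendant [simp]: "pverts (attach_pendant G v x) = insert x (pverts G)"
  by (simp add: attach_pendant_def)

lemma pverts_add_edge [simp]: "pverts (add_edge G x y) = pverts G"
  by (simp add: add_edge_def)

lemma neighbours_attach_pendant:
  "neighbours (attach_pendant G v x) i =
    neighbours G i \<union> (if i = v then {x} else {}) \<union> (if i = x then {v} else {})"
  by (auto simp: neighbours_def attach_pendant_def)

lemma neighbours_add_edge:
  "neighbours (add_edge G x y) i =
    neighbours G i \<union> (if i = x then {y} else {}) \<union> (if i = y then {x} else {})"
  by (auto simp: neighbours_def add_edge_def)

lemma uedges_attach_pendant: "uedges (attach_pendant G v x) = insert {v, x} (uedges G)"
  by (auto simp: uedges_def attach_pendant_def insert_commute)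

lemma uedges_add_edge: "uedges (add_edge G x y) = insert {x, y} (uedges G)"
  by (auto simp: uedges_def add_edge_def insert_commute)

lemma connected_simple_graph_attach_pendant:
  assumes "connected_simple_graph G" "v \<in> pverts G" "x \<notin> pverts G"
  shows "connected_simple_graph (attach_pendant G v x)"
proof -
  interpret connected_simple_graph G by fact
  let ?E = "parcs (attach_pendant G v x)"
  have E: "?E = parcs G \<union> {(v, x), (x, v)}"
    by (simp add: attach_pendant_def)
  have old: "(y, z) \<in> ?E\<^sup>*" if "y \<in> V" "z \<in> V" for y z
    using reach[OF that] rtrancl_mono[of "parcs G" ?E] E by auto
  have "(y, v) \<in> ?E\<^sup>* \<and> (v, y) \<in> ?E\<^sup>*" if "y \<in> insert x V" for y
    using that old assms(2) E by auto
  then have "(y, z) \<in> ?E\<^sup>*" if "y \<in> insert x V" "z \<in> insert x V" for y z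
    using that by (meson rtrancl_trans)
  then show ?thesis
    using finite_verts arcs_verts arcs_sym no_loop assms
    by unfold_locales (auto simp: E)
qed

lemma connected_simple_graph_add_edge:
  assumes "connected_simple_graph G" "x \<in> pverts G" "y \<in> pverts G" "x \<noteq> y"
  shows "connected_simple_graph (add_edge G x y)"
proof -
  interpret connected_simple_graph G by fact
  let ?E = "parcs (add_edge G x y)"
  have E: "?E = parcs G \<union> {(x, y), (y, x)}"
    by (simp add: add_edge_def)
  have "(y, z) \<in> ?E\<^sup>*" if "y \<in> V" "z \<in> V" for y z
    using reach[OF that] rtrancl_mono[of "parcs G" ?E] E by auto
  then show ?thesis
    using finite_verts arcs_verts arcs_sym no_loop assms
    by unfold_locales (auto simp: E)
qed

lemma connected_simple_graph_pair_graph: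
  assumes "pair_graph G" "Digraph_Component.connected (with_proj G)" "parcs G \<noteq> {}"
  shows "connected_simple_graph G"
proof -
  interpret pair_graph G by fact
  have symE: "(y, x) \<in> parcs G" if "(x, y) \<in> parcs G" for x y
    using that arcs_symmetric by auto
  \<comment> \<open>Connectedness is defined through the symmetric closure, which adds nothing to an
    already symmetric arc set.\<close>
  have "parcs (mk_symmetric (with_proj G)) = parcs G"
    using symE by (auto simp: parcs_mk_symmetric)
  then have reach: "(x, y) \<in> rtrancl_on (pverts G) (parcs G)" if "x \<in> pverts G" "y \<in> pverts G" for x y
    using assms(2) that
    by (auto simp: Digraph_Component.connected_def strongly_connected_def reachable_def)
  have "(x, y) \<in> (parcs G)\<^sup>*" if "x \<in> pverts G" "y \<in> pverts G" for x y
    using reach[OF that] by (rule rtrancl_on_rtranclI)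
  moreover have "parcs G \<subseteq> pverts G \<times> pverts G"
    using arc_fst_in_verts arc_snd_in_verts by fastforce
  moreover have "(x, x) \<notin> parcs G" for x
    using pair_no_loops by fastforce
  ultimately show ?thesis
    using assms(3) symE pair_finite_verts by (intro connected_simple_graph.intro)
qed

section \<open>Three new vertices attached at a cut vertex\<close>

locale three_vertex_extension =
  G: connected_simple_graph G + H: connected_simple_graph H
  for G H :: "'a pair_pre_digraph" +
  fixes v a b c :: 'a
  assumes v: "v \<in> pverts G"
    and new: "a \<notin> pverts G" "b \<notin> pverts G" "c \<notin> pverts G"
    and dist: "a \<noteq> b" "a \<noteq> c" "b \<noteq> c"
    and verts: "pverts H = pverts G \<union> {a, b, c}"
    and neighbours_off: "i \<in> pverts G \<Longrightarrow> i \<noteq> v \<Longrightarrow> neighbours H i = neighbours G i"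
    and neighbours_v: "neighbours H v = neighbours G v \<union> {a, b, c}"
begin

lemma new_disjoint: "neighbours G v \<inter> {a, b, c} = {}"
  using new G.neighbours_subset by auto

lemma degree_off: "i \<in> pverts G \<Longrightarrow> i \<noteq> v \<Longrightarrow> vertex_degree H i = vertex_degree G i"
  by (simp add: vertex_degree_def neighbours_off)

lemma degree_v: "vertex_degree H v = vertex_degree G v + 3"
  unfolding vertex_degree_def neighbours_v
  using dist by (subst card_Un_disjoint[OF G.finite_neighbours _ new_disjoint]) auto

lemma laplacian_off: "i \<in> pverts G \<Longrightarrow> i \<noteq> v \<Longrightarrow> laplacian H f i = laplacian G f i"
  by (simp add: laplacian_def neighbours_off)

lemma laplacian_v: "laplacian H f v = laplacian G f v + (3 * f v - f a - f b - f c)"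
  unfolding laplacian_def neighbours_v
  using dist by (subst sum.union_disjoint[OF G.finite_neighbours _ new_disjoint]) auto

text \<open>The edges among \<open>a\<close>, \<open>b\<close>, \<open>c\<close> enter only through
  the excess \<open>e\<close>. The summand 3 comes from the larger degree of \<open>v\<close>; for a
  gadget with \<open>M\<close> edges \<open>e\<close> is \<open>2 * M - 3\<close>, so the correction
  at \<open>v\<close> is \<open>2 * M\<close>.\<close>

lemma laplacian_old_target:
  assumes "j \<in> pverts G" "i \<in> pverts G" "i \<noteq> j"
    and "hitting_time H a j + hitting_time H b j + hitting_time H c j = 3 * hitting_time H v j + e"
  shows "laplacian G (\<lambda>i. hitting_time H i j) i =
    real (vertex_degree G i) + (if i = v then 3 + e else 0)"
proof (cases "i = v")
  case True
  have "laplacian H (\<lambda>i. hitting_time H i j) v = vertex_degree H v"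
    using assms True verts by (intro H.laplacian_hitting_time) auto
  then show ?thesis
    using True assms(4) by (simp add: laplacian_v degree_v)
next
  case False
  have "laplacian H (\<lambda>i. hitting_time H i j) i = vertex_degree H i"
    using assms verts by (intro H.laplacian_hitting_time) auto
  then show ?thesis
    using False assms by (simp add: laplacian_off degree_off)
qed

text \<open>With the target outside \<open>G\<close>, the hitting time equation of \<open>H\<close>
  holds on all of \<open>G\<close>. The zero sum of the Laplacian of \<open>G\<close> then
  determines its value at \<open>v\<close>, whatever \<open>G\<close> looks like.\<close>

lemma new_target:
  assumes w: "w \<in> {a, b, c}"
  shows "3 * hitting_time H v w - hitting_time H a w - hitting_time H b w - hitting_time H c w =
    2 * real (card (uedges G)) + 3"
proof -
  let ?h = "\<lambda>i. hitting_time H i w"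
  have lap: "laplacian H ?h i = vertex_degree H i" if "i \<in> pverts G" for i
    using that w new verts by (intro H.laplacian_hitting_time) auto
  have "laplacian G ?h i = vertex_degree G i" if "i \<in> pverts G" "i \<noteq> v" for i
    using lap[OF that(1)] that by (simp add: laplacian_off degree_off)
  then have "laplacian G ?h v = - (2 * real (card (uedges G)) - vertex_degree G v)"
    using G.laplacian_at_target[OF v, of ?h "\<lambda>i. vertex_degree G i"] G.sum_deg_remove[OF v] by simp
  then show ?thesis
    using lap[OF v] by (simp add: laplacian_v degree_v)
qed

lemma kemeny_extension:
  "kemeny H = ((\<Sum>j\<in>pverts G. vertex_degree G j * hitting_time H v j) +
    vertex_degree H a * hitting_time H v a + vertex_degree H b * hitting_time H v b +
    vertex_degree H c * hitting_time H v c) / (2 * card (uedges H))"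
proof -
  have "(\<Sum>j\<in>pverts G \<union> {a, b, c}. vertex_degree H j * hitting_time H v j) =
      (\<Sum>j\<in>pverts G. vertex_degree H j * hitting_time H v j) +
      (\<Sum>j\<in>{a, b, c}. vertex_degree H j * hitting_time H v j)"
    using new by (intro sum.union_disjoint G.finite_verts) auto
  also have "(\<Sum>j\<in>pverts G. vertex_degree H j * hitting_time H v j) =
      (\<Sum>j\<in>pverts G. vertex_degree G j * hitting_time H v j)"
  proof (rule sum.cong)
    fix j assume "j \<in> pverts G"
    \<comment> \<open>The degree changes only at \<open>v\<close>, where the hitting time from
      \<open>v\<close> is 0.\<close>
    then show "vertex_degree H j * hitting_time H v j = vertex_degree G j * hitting_time H v j"
      by (cases "j = v") (auto simp: degree_off H.hitting_time_same)
  qed simp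
  finally show ?thesis
    using H.kemeny_eq[of v] v dist verts by (simp add: add_ac)
qed

lemma laplacian_new_vertex:
  assumes "w \<in> {a, b, c}" "j \<in> pverts H" "w \<noteq> j"
  shows "laplacian H (\<lambda>i. hitting_time H i j) w = vertex_degree H w"
proof (rule H.laplacian_hitting_time)
  show "w \<in> pverts H"
    using assms(1) verts by blast
qed (use assms in simp_all)

end

text \<open>\<open>M\<close> and \<open>M'\<close> stand for the numbers of gadget edges in
  \<open>H\<close> and \<open>H'\<close>. The inequality is the one needed after cross-multiplying
  by the total edge counts in the two Kemeny constants.\<close>

lemma hitting_time_comparison:
  fixes M M' :: real
  assumes "three_vertex_extension G H v a b c" "three_vertex_extension G H' v a b c"
    and j: "j \<in> pverts G"
    and e: "hitting_time H a j + hitting_time H b j + hitting_time H c j =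
      3 * hitting_time H v j + (2 * M - 3)"
    and e': "hitting_time H' a j + hitting_time H' b j + hitting_time H' c j =
      3 * hitting_time H' v j + (2 * M' - 3)"
    and M: "M \<le> M'"
  shows "(card (uedges G) + M') * hitting_time H v j \<le> (card (uedges G) + M) * hitting_time H' v j"
proof (cases "j = v")
  case True
  interpret H: three_vertex_extension G H v a b c by fact
  interpret H': three_vertex_extension G H' v a b c by fact
  show ?thesis
    using True by (simp add: H.H.hitting_time_same H'.H.hitting_time_same)
next
  case False
  interpret H: three_vertex_extension G H v a b c by fact
  interpret H': three_vertex_extension G H' v a b c by fact
  let ?m = "real (card (uedges G))" and ?d = "\<lambda>i. real (vertex_degree G i)"
  let ?\<delta> = "M' - M"
  \<comment> \<open>With these weights the terms in \<open>M * M'\<close> cancel at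
    \<open>v\<close>, so the Laplacian of \<open>u\<close> is proportional to
    \<open>M' - M\<close>.\<close>
  define u where "u i = (?m + M) * hitting_time H' i j - (?m + M') * hitting_time H i j" for i
  have lap: "laplacian G u i = ?\<delta> * (2 * ?m * (if i = v then 1 else 0) - ?d i)"
    if "i \<in> pverts G" "i \<noteq> j" for i
    unfolding u_def laplacian_diff laplacian_cmult
    using H.laplacian_old_target[OF j that e] H'.laplacian_old_target[OF j that e']
    by (simp add: algebra_simps)
  have "laplacian G u j = - (\<Sum>i\<in>pverts G - {j}. ?\<delta> * (2 * ?m * (if i = v then 1 else 0) - ?d i))"
    by (rule H.G.laplacian_at_target[OF j lap])
  also have "\<dots> = - ?\<delta> * (2 * ?m * (\<Sum>i\<in>pverts G - {j}. if i = v then 1 else 0) -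
      (\<Sum>i\<in>pverts G - {j}. ?d i))"
    by (simp only: sum_distrib_left[symmetric] sum_subtractf mult_minus_left)
  \<comment> \<open>The vertex \<open>v\<close> is still in the sum because \<open>j\<close> differs
    from \<open>v\<close>. Its \<open>2 * ?m\<close> outweighs the remaining degrees by exactly
    \<open>?d j\<close>, so the formula valid off \<open>v\<close> also holds at the target.\<close>
  also have "(\<Sum>i\<in>pverts G - {j}. if i = v then 1 else 0) = (1 :: real)"
    using False H.v H.G.finite_verts by (subst sum.delta) auto
  finally have "laplacian G u j = - ?\<delta> * ?d j"
    using H.G.sum_deg_remove[OF j] by simp
  then have "laplacian G u i \<le> 0" if "i \<in> pverts G" "i \<noteq> v" for i
    using lap[of i] that M by (cases "i = j") (auto simp: mult_nonpos_nonneg mult_nonneg_nonpos)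
  then have "u j \<le> u v"
    by (rule H.G.maximum_principle[OF H.v j])
  then show ?thesis
    by (simp add: u_def H.H.hitting_time_same H'.H.hitting_time_same)
qed

section \<open>Comparison of the two gadgets\<close>

theorem theorem4p14:
  fixes G Gbar Gtilde Gstar :: "'a pair_pre_digraph" and v a b c :: 'a
  assumes "pair_graph G"
    and "Digraph_Component.connected (with_proj G)"
    and "card (uedges G) \<ge> 4"
    and "v \<in> pverts G"
    and "a \<notin> pverts G" and "b \<notin> pverts G" and "c \<notin> pverts G"
    and "distinct [a, b, c]"
    and "Gbar = attach_pendant (attach_pendant (attach_pendant G v a) v b) v c"
    and "Gtilde = add_edge Gbar a b"
    and "Gstar = add_edge (add_edge (add_edge Gbar a b) b c) a c"
  shows "kemeny Gstar > kemeny Gtilde"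
proof -
  have ab: "a \<noteq> b" "a \<noteq> c" "b \<noteq> c" and v: "v \<noteq> a" "v \<noteq> b" "v \<noteq> c"
    using assms by auto
  have "parcs G \<noteq> {}"
    using assms(3) by (auto simp: uedges_def)
  then have G: "connected_simple_graph G"
    using assms connected_simple_graph_pair_graph by blast
  then interpret G: connected_simple_graph G .
  have bar: "connected_simple_graph Gbar"
    unfolding assms(9) using G assms(4-8) by (intro connected_simple_graph_attach_pendant) auto
  have tilde: "connected_simple_graph Gtilde"
    unfolding assms(10) using bar ab by (intro connected_simple_graph_add_edge) (auto simp: assms(9))
  have star: "connected_simple_graph Gstar"
    unfolding assms(11) using bar ab
    by (intro connected_simple_graph_add_edge) (auto simp: assms(9))
  have G_new: "neighbours G a = {}" "neighbours G b = {}" "neighbours G c = {}"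
    using assms(5-7) G.arcs_verts by (auto simp: neighbours_def)
  note nbs = neighbours_attach_pendant neighbours_add_edge assms(9-11)
  have nb: "neighbours Gtilde a = {v, b}" "neighbours Gtilde b = {v, a}" "neighbours Gtilde c = {v}"
    "neighbours Gstar a = {v, b, c}" "neighbours Gstar b = {v, a, c}" "neighbours Gstar c = {v, a, b}"
    using ab v G_new by (auto simp: nbs)
  have ext_tilde: "three_vertex_extension G Gtilde v a b c"
    using G tilde assms(4-7) ab v
    by (intro three_vertex_extension.intro three_vertex_extension_axioms.intro) (auto simp: nbs)
  have ext_star: "three_vertex_extension G Gstar v a b c"
    using G star assms(4-7) ab v
    by (intro three_vertex_extension.intro three_vertex_extension_axioms.intro) (auto simp: nbs)
  interpret T: three_vertex_extension G Gtilde v a b c by fact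
  interpret S: three_vertex_extension G Gstar v a b c by fact
  let ?m = "real (card (uedges G))"
  let ?t = "hitting_time Gtilde" and ?s = "hitting_time Gstar"
  have fin: "finite (uedges G)"
    using G.finite_arcs by (simp add: uedges_def)
  have sub: "e \<subseteq> pverts G" if "e \<in> uedges G" for e
    using that G.arcs_verts by (auto simp: uedges_def)
  have notin: "{x, y} \<notin> uedges G" if "y \<in> {a, b, c}" for x y
    using sub[of "{x, y}"] that assms(5-7) by auto
  have card_tilde: "card (uedges Gtilde) = card (uedges G) + 4"
    using fin notin ab v
    by (simp add: assms(9,10) uedges_attach_pendant uedges_add_edge doubleton_eq_iff)
  have card_star: "card (uedges Gstar) = card (uedges G) + 6"
    using fin notin ab v
    by (simp add: assms(9,11) uedges_attach_pendant uedges_add_edge doubleton_eq_iff)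
  have deg: "vertex_degree Gtilde a = 2" "vertex_degree Gtilde b = 2" "vertex_degree Gtilde c = 1"
    "vertex_degree Gstar a = 3" "vertex_degree Gstar b = 3" "vertex_degree Gstar c = 3"
    using ab v by (auto simp: vertex_degree_def nb)

  \<comment> \<open>Hitting time equations at the gadget vertices. They serve both for targets in
    \<open>G\<close>, where they give the excesses 5 and 9, and for targets in the gadget.\<close>
  have eq_ta: "2 * ?t a j = 2 + ?t v j + ?t b j" if "j \<in> pverts Gtilde" "j \<noteq> a" for j
    using T.laplacian_new_vertex[of a j] that ab v by (simp add: laplacian_def nb deg)
  have eq_tb: "2 * ?t b j = 2 + ?t v j + ?t a j" if "j \<in> pverts Gtilde" "j \<noteq> b" for j
    using T.laplacian_new_vertex[of b j] that ab v by (simp add: laplacian_def nb deg)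
  have eq_tc: "?t c j = 1 + ?t v j" if "j \<in> pverts Gtilde" "j \<noteq> c" for j
    using T.laplacian_new_vertex[of c j] that ab v by (simp add: laplacian_def nb deg)
  have eq_sa: "3 * ?s a j = 3 + ?s v j + ?s b j + ?s c j" if "j \<in> pverts Gstar" "j \<noteq> a" for j
    using S.laplacian_new_vertex[of a j] that ab v by (simp add: laplacian_def nb deg)
  have eq_sb: "3 * ?s b j = 3 + ?s v j + ?s a j + ?s c j" if "j \<in> pverts Gstar" "j \<noteq> b" for j
    using S.laplacian_new_vertex[of b j] that ab v by (simp add: laplacian_def nb deg)
  have eq_sc: "3 * ?s c j = 3 + ?s v j + ?s a j + ?s b j" if "j \<in> pverts Gstar" "j \<noteq> c" for j
    using S.laplacian_new_vertex[of c j] that ab v by (simp add: laplacian_def nb deg)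
  have V: "pverts Gtilde = pverts G \<union> {a, b, c}" "pverts Gstar = pverts G \<union> {a, b, c}"
    by (fact T.verts S.verts)+

  \<comment> \<open>For each gadget target, \<open>new_target\<close> and the equations at the other
    two gadget vertices determine the time from \<open>v\<close> and from those two
    vertices.\<close>
  have t_a: "?t v a = (4 * ?m + 10) / 3"
    using T.new_target[of a] eq_tb[of a] eq_tc[of a] ab V T.H.hitting_time_same[of a] by simp
  have t_b: "?t v b = (4 * ?m + 10) / 3"
    using T.new_target[of b] eq_ta[of b] eq_tc[of b] ab V T.H.hitting_time_same[of b] by simp
  have t_c: "?t v c = 2 * ?m + 7"
    using T.new_target[of c] eq_ta[of c] eq_tb[of c] ab V T.H.hitting_time_same[of c] by simp
  have s_a: "?s v a = ?m + 3"
    using S.new_target[of a] eq_sb[of a] eq_sc[of a] ab V S.H.hitting_time_same[of a] by simp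
  have s_b: "?s v b = ?m + 3"
    using S.new_target[of b] eq_sa[of b] eq_sc[of b] ab V S.H.hitting_time_same[of b] by simp
  have s_c: "?s v c = ?m + 3"
    using S.new_target[of c] eq_sa[of c] eq_sb[of c] ab V S.H.hitting_time_same[of c] by simp

  define A where "A = (\<Sum>j\<in>pverts G. vertex_degree G j * ?s v j)"
  define B where "B = (\<Sum>j\<in>pverts G. vertex_degree G j * ?t v j)"
  have "(?m + 6) * ?t v j \<le> (?m + 4) * ?s v j" if j: "j \<in> pverts G" for j
  proof (rule hitting_time_comparison[OF ext_tilde ext_star j])
    have jn: "j \<noteq> a" "j \<noteq> b" "j \<noteq> c" "j \<in> pverts Gtilde" "j \<in> pverts Gstar"
      using j assms(5-7) V by auto
    show "?t a j + ?t b j + ?t c j = 3 * ?t v j + (2 * 4 - 3)"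
      using eq_ta[of j] eq_tb[of j] eq_tc[of j] jn by simp
    show "?s a j + ?s b j + ?s c j = 3 * ?s v j + (2 * 6 - 3)"
      using eq_sa[of j] eq_sb[of j] eq_sc[of j] jn by simp
  qed simp
  then have "(\<Sum>j\<in>pverts G. vertex_degree G j * ((?m + 6) * ?t v j)) \<le>
      (\<Sum>j\<in>pverts G. vertex_degree G j * ((?m + 4) * ?s v j))"
    by (intro sum_mono mult_left_mono) auto
  then have AB: "(?m + 6) * B \<le> (?m + 4) * A"
    unfolding A_def B_def sum_distrib_left by (simp add: mult.left_commute)

  have frac_less: "x / (2 * p) < y / (2 * q)" if "q * x < p * y" "p > 0" "q > 0" for x y p q :: real
    using that by (simp add: field_simps)
  have m4: "?m \<ge> 4"
    using assms(3) by simp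
  have "4 * ?m \<le> ?m * ?m"
    using m4 by (intro mult_right_mono) auto
  \<comment> \<open>Here \<open>q\<close> stands for the square of \<open>n\<close>, which makes the
    claim linear: the numerator is at least \<open>16 * n - 42\<close>, hence at least 22.\<close>
  moreover have "0 < (5 * q - 4 * n - 42) / 3" if "4 * n \<le> q" "4 \<le> n" for q n :: real
    using that by simp
  ultimately have "0 < (5 * (?m * ?m) - 4 * ?m - 42) / 3"
    using m4 by blast
  \<comment> \<open>The gadget contributions to the degree-weighted sums: degrees 3, 3, 3 with time
    \<open>?m + 3\<close> each, against degrees 2, 2, 1 with the times \<open>t_a\<close>,
    \<open>t_b\<close>, \<open>t_c\<close>.\<close>
  also have "\<dots> = (?m + 4) * (9 * (?m + 3)) - (?m + 6) * ((22 * ?m + 61) / 3)"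
    by (simp add: field_simps)
  finally have "(?m + 6) * (B + (22 * ?m + 61) / 3) < (?m + 4) * (A + 9 * (?m + 3))"
    unfolding distrib_left[of _ A] distrib_left[of _ B]
    using AB by (simp only: diff_gt_0_iff_gt add_le_less_mono)
  then have "(B + (22 * ?m + 61) / 3) / (2 * (?m + 4)) < (A + 9 * (?m + 3)) / (2 * (?m + 6))"
    using m4 by (intro frac_less) auto
  moreover have "kemeny Gtilde = (B + (22 * ?m + 61) / 3) / (2 * (?m + 4))"
    unfolding T.kemeny_extension B_def[symmetric] by (simp add: deg t_a t_b t_c card_tilde)
  moreover have "kemeny Gstar = (A + 9 * (?m + 3)) / (2 * (?m + 6))"
    unfolding S.kemeny_extension A_def[symmetric] by (simp add: deg s_a s_b s_c card_star)
  ultimately show ?thesis by (simp only:)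
qed

end
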